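(* The search problem $\mathrm{Schrijver}(n,k,\lfloor n/2\rfloor-2k+1)$ is polynomial-time reducible to the search problem $\mathrm{Kneser}$ (both in the white-box input model).
   Context: Write $[n]=\{1,\ldots,n\}$, let $\binom{[n]}{k}$ be the family of all $k$-subsets of $[n]$. A subset of $[n]$ is stable if it contains no two consecutive elements and does not contain both $1$ and $n$. Let $\binom{[n]}{k}_{\mathrm{stab}}$ be the family of stable $k$-subsets of $[n]$. For positive integers $n\ge 2k$, the Kneser graph $K(n,k)$ has vertex set $\binom{[n]}{k}$, with two sets adjacent if and only if they are disjoint; the Schrijver graph $S(n,k)$ is its subgraph induced by $\binom{[n]}{k}_{\mathrm{stab}}$. Problem $\mathrm{Schrijver}(n,k,m)$, for a function $m=m(n,k)$: given positive integers $n,k$ with $n\ge 2k$ and a (not necessarily proper) coloring $c:\binom{[n]}{k}_{\mathrm{stab}}\to[m]$ with $m=m(n,k)$, find $A,B\in\binom{[n]}{k}_{\mathrm{stab}}$ with $A\cap B=\emptyset$ and $c(A)=c(B)$. Problem $\mathrm{Kneser}$: given positive integers $n,k$ with $n\ge 2k$ and a (not necessarily proper) coloring $c:\binom{[n]}{k}\to[n-2k+1]$, find $A,B\in\binom{[n]}{k}$ with $A\cap B=\emptyset$ and $c(A)=c(B)$. In the white-box input model, the coloring $c$ is given by a Boolean circuit that computes $c(A)$ from a vertex $A$. A search problem $P$ is polynomial-time reducible to a search problem $Q$ if there are polynomial-time computable maps, one taking each instance of $P$ to an instance of $Q$, and one taking each instance of $P$ together with any solution of the corresponding instance of $Q$ to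 a solution of the instance of $P$. *)

theory Defs
  imports Complex_Main "HOL-Computational_Algebra.Polynomial"
begin

section \<open>Multi-tape Turing machines\<close>

text \<open>
  The tapes are infinite to the right, the tape alphabet consists of the blank None and the two
  bits, the states are 0, ..., num_states M, with initial state 0 and halting state num_states M.
  The transition function takes the state and the list of scanned symbols. Only its values on
  states below num_states M and on lists of length num_tapes M matter (see \<open>wf_tm\<close>), so that it
  amounts to a finite table.
\<close>

type_synonym symbol = "bool option"
type_synonym tape = "(nat \<Rightarrow> symbol) \<times> nat"
type_synonym config = "nat \<times> tape list"

datatype dir = Left | Stay | Right

record tm =
  num_states :: nat
  num_tapes :: nat
  trans :: "nat \<Rightarrow> symbol list \<Rightarrow> nat \<times> (symbol \<times> dir) list"

definition wf_tm :: "tm \<Rightarrow> bool" where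
  "wf_tm M \<longleftrightarrow> num_tapes M \<ge> 2 \<and>
     (\<forall>q < num_states M. \<forall>rs. length rs = num_tapes M \<longrightarrow>
        fst (trans M q rs) \<le> num_states M \<and> length (snd (trans M q rs)) = num_tapes M)"

fun move :: "dir \<Rightarrow> nat \<Rightarrow> nat" where
  "move Left p = p - 1"
| "move Stay p = p"
| "move Right p = p + 1"

definition act :: "symbol \<times> dir \<Rightarrow> tape \<Rightarrow> tape" where
  "act a t = ((fst t)(snd t := fst a), move (snd a) (snd t))"

definition step :: "tm \<Rightarrow> config \<Rightarrow> config" where
  "step M c =
     (if fst c = num_states M then c
      else let (q, as) = trans M (fst c) (map (\<lambda>(t, p). t p) (snd c))
           in (q, map2 act as (snd c)))"

definition word :: "bool list \<Rightarrow> nat \<Rightarrow> symbol" where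
  "word xs i = (if i < length xs then Some (xs ! i) else None)"

definition init_config :: "tm \<Rightarrow> bool list \<Rightarrow> config" where
  "init_config M x = (0, (word x, 0) # replicate (num_tapes M - 1) (word [], 0))"

text \<open>Tape 0 is the input tape and tape 1 the output tape. Halting configurations are fixed points
  of \<open>step\<close>, so the following says that M halts after at most T steps with output y.\<close>

definition outputs_within :: "tm \<Rightarrow> bool list \<Rightarrow> nat \<Rightarrow> bool list \<Rightarrow> bool" where
  "outputs_within M x T y \<longleftrightarrow>
     (let c = (step M ^^ T) (init_config M x)
      in fst c = num_states M \<and> fst (snd c ! 1) = word y)"

text \<open>Polynomial-time computability of f on the domain D, where ea and eb encode the arguments and
  the values of f as bit strings.\<close>

definition poly_time_computable ::
  "'a set \<Rightarrow> ('a \<Rightarrow> bool list) \<Rightarrow> ('b \<Rightarrow> bool list) \<Rightarrow> ('a \<Rightarrow> 'b) \<Rightarrow> bool" where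
  "poly_time_computable D ea eb f \<longleftrightarrow>
     (\<exists>M (p :: nat poly). wf_tm M \<and>
        (\<forall>x\<in>D. outputs_within M (ea x) (poly p (length (ea x))) (eb (f x))))"


section \<open>Search problems and reductions\<close>

record ('i, 's) search_problem =
  instances :: "'i set"
  solutions :: "'i \<Rightarrow> 's set"
  enc_inst :: "'i \<Rightarrow> bool list"
  enc_sol :: "'s \<Rightarrow> bool list"

text \<open>The bits of x are doubled, and 01 serves as a separator.\<close>

definition enc_pair :: "bool list \<Rightarrow> bool list \<Rightarrow> bool list" where
  "enc_pair x y = concat (map (\<lambda>b. [b, b]) x) @ [False, True] @ y"

definition poly_time_reducible ::
  "('i, 's) search_problem \<Rightarrow> ('j, 't) search_problem \<Rightarrow> bool" where
  "poly_time_reducible P Q \<longleftrightarrow>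
     (\<exists>f g.
        poly_time_computable (instances P) (enc_inst P) (enc_inst Q) f \<and>
        poly_time_computable {(x, y). x \<in> instances P \<and> y \<in> solutions Q (f x)}
          (\<lambda>(x, y). enc_pair (enc_inst P x) (enc_sol Q y)) (enc_sol P) g \<and>
        (\<forall>x \<in> instances P. f x \<in> instances Q \<and>
           (\<forall>y \<in> solutions Q (f x). g (x, y) \<in> solutions P x)))"


section \<open>Boolean circuits\<close>

text \<open>
  A circuit is a list of gates together with the list of its output gates. The gates are numbered
  from 0 on, and every gate refers to gates with smaller numbers only. The input variables of a
  circuit with n inputs are numbered 1, ..., n.
\<close>

datatype gate = Input nat | Const bool | Not nat | And nat nat | Or nat nat

type_synonym circuit = "gate list \<times> nat list"

fun wf_gate :: "nat \<Rightarrow> nat \<Rightarrow> gate \<Rightarrow> bool" where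
  "wf_gate n j (Input i) \<longleftrightarrow> i \<in> {1..n}"
| "wf_gate n j (Const b) \<longleftrightarrow> True"
| "wf_gate n j (Not a) \<longleftrightarrow> a < j"
| "wf_gate n j (And a b) \<longleftrightarrow> a < j \<and> b < j"
| "wf_gate n j (Or a b) \<longleftrightarrow> a < j \<and> b < j"

definition wf_circuit :: "nat \<Rightarrow> circuit \<Rightarrow> bool" where
  "wf_circuit n C \<longleftrightarrow>
     (\<forall>j < length (fst C). wf_gate n j (fst C ! j)) \<and> (\<forall>j \<in> set (snd C). j < length (fst C))"

fun eval_gate :: "(nat \<Rightarrow> bool) \<Rightarrow> bool list \<Rightarrow> gate \<Rightarrow> bool" where
  "eval_gate \<xi> vs (Input i) = \<xi> i"
| "eval_gate \<xi> vs (Const b) = b"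
| "eval_gate \<xi> vs (Not a) = (\<not> vs ! a)"
| "eval_gate \<xi> vs (And a b) = (vs ! a \<and> vs ! b)"
| "eval_gate \<xi> vs (Or a b) = (vs ! a \<or> vs ! b)"

definition eval_circuit :: "(nat \<Rightarrow> bool) \<Rightarrow> circuit \<Rightarrow> bool list" where
  "eval_circuit \<xi> C = map ((!) (foldl (\<lambda>vs g. vs @ [eval_gate \<xi> vs g]) [] (fst C))) (snd C)"

text \<open>The colour computed by a circuit from (the characteristic vector of) the set A; the output
  bits form its binary representation, least significant bit first.\<close>

definition circuit_colour :: "circuit \<Rightarrow> nat set \<Rightarrow> int" where
  "circuit_colour C A = horner_sum of_bool 2 (eval_circuit (\<lambda>i. i \<in> A) C)"


section \<open>Encodings as bit strings\<close>

text \<open>Binary representation, least significant bit first, without leading zeros.\<close>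

fun bits :: "nat \<Rightarrow> bool list" where
  "bits n = (if n = 0 then [] else odd n # bits (n div 2))"

declare bits.simps [simp del]

definition enc_list :: "('a \<Rightarrow> bool list) \<Rightarrow> 'a list \<Rightarrow> bool list" where
  "enc_list e xs = concat (map (\<lambda>x. True # e x) xs) @ [False]"

definition enc_nat :: "nat \<Rightarrow> bool list" where
  "enc_nat n = enc_list (\<lambda>b. [b]) (bits n)"

fun enc_gate :: "gate \<Rightarrow> bool list" where
  "enc_gate (Const b) = [False, False, b]"
| "enc_gate (Input i) = [False, True, False] @ enc_nat i"
| "enc_gate (Not a) = [False, True, True] @ enc_nat a"
| "enc_gate (And a b) = [True, False] @ enc_nat a @ enc_nat b"
| "enc_gate (Or a b) = [True, True] @ enc_nat a @ enc_nat b"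

definition enc_circuit :: "circuit \<Rightarrow> bool list" where
  "enc_circuit C = enc_list enc_gate (fst C) @ enc_list enc_nat (snd C)"

text \<open>The number n of circuit inputs is written in unary: the size of a circuit is understood to
  count all its n input nodes, whereas in the representation above unused inputs leave no trace.\<close>

fun enc_instance :: "nat \<times> nat \<times> circuit \<Rightarrow> bool list" where
  "enc_instance (n, k, C) = replicate n True @ [False] @ enc_nat k @ enc_circuit C"

definition enc_set :: "nat set \<Rightarrow> bool list" where
  "enc_set A = enc_list enc_nat (sorted_list_of_set A)"

fun enc_sets :: "nat set \<times> nat set \<Rightarrow> bool list" where
  "enc_sets (A, B) = enc_set A @ enc_set B"


section \<open>The problems Schrijver and Kneser\<close>

definition k_subsets :: "nat \<Rightarrow> nat \<Rightarrow> nat set set" where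
  "k_subsets n k = {A. A \<subseteq> {1..n} \<and> card A = k}"

definition stable :: "nat \<Rightarrow> nat set \<Rightarrow> bool" where
  "stable n A \<longleftrightarrow> (\<forall>i. \<not> (i \<in> A \<and> i + 1 \<in> A)) \<and> \<not> (1 \<in> A \<and> n \<in> A)"

definition stable_k_subsets :: "nat \<Rightarrow> nat \<Rightarrow> nat set set" where
  "stable_k_subsets n k = {A \<in> k_subsets n k. stable n A}"

text \<open>The common form of both problems, with V n k as the vertex set and m n k as the number of
  colours. The value m n k may be nonpositive, and then there are no instances with these n and k.\<close>

definition monochromatic_edge_problem ::
  "(nat \<Rightarrow> nat \<Rightarrow> nat set set) \<Rightarrow> (nat \<Rightarrow> nat \<Rightarrow> int) \<Rightarrow>
     (nat \<times> nat \<times> circuit, nat set \<times> nat set) search_problem" where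
  "monochromatic_edge_problem V m =
     \<lparr> instances = {(n, k, C). 0 < n \<and> 0 < k \<and> 2 * k \<le> n \<and> wf_circuit n C \<and>
                     (\<forall>A \<in> V n k. circuit_colour C A \<in> {1..m n k})},
       solutions = (\<lambda>(n, k, C). {(A, B). A \<in> V n k \<and> B \<in> V n k \<and> A \<inter> B = {} \<and>
                                   circuit_colour C A = circuit_colour C B}),
       enc_inst = enc_instance,
       enc_sol = enc_sets \<rparr>"

definition Schrijver ::
  "(nat \<Rightarrow> nat \<Rightarrow> int) \<Rightarrow> (nat \<times> nat \<times> circuit, nat set \<times> nat set) search_problem" where
  "Schrijver m = monochromatic_edge_problem stable_k_subsets m"

definition Kneser :: "(nat \<times> nat \<times> circuit, nat set \<times> nat set) search_problem" where
  "Kneser = monochromatic_edge_problem k_subsets (\<lambda>n k. int n - 2 * int k + 1)"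


section \<open>The encodings are injective\<close>

lemma bits_inject: "bits m = bits n \<longleftrightarrow> m = n"
proof
  show "bits m = bits n \<Longrightarrow> m = n"
  proof (induction m arbitrary: n rule: bits.induct)
    case (1 m)
    show ?case
    proof (cases "m = 0 \<or> n = 0")
      case True
      with "1.prems" show ?thesis by (simp add: bits.simps [of m] bits.simps [of n] split: if_splits)
    next
      case False
      with "1.prems" have *: "odd m = odd n" "bits (m div 2) = bits (n div 2)"
        by (simp_all add: bits.simps [of m] bits.simps [of n])
      from False "1.IH" *(2) have "m div 2 = n div 2" by blast
      with *(1) show ?thesis by (metis bit_eq_rec even_iff_mod_2_eq_zero)
    qed
  qed
qed simp

definition prefix_code :: "('a \<Rightarrow> bool list) \<Rightarrow> bool" where
  "prefix_code e \<longleftrightarrow> (\<forall>x y r s. e x @ r = e y @ s \<longrightarrow> x = y \<and> r = s)"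

lemma prefix_codeD: "prefix_code e \<Longrightarrow> e x @ r = e y @ s \<Longrightarrow> x = y \<and> r = s"
  unfolding prefix_code_def by blast

lemma prefix_code_inj: "prefix_code e \<Longrightarrow> inj e"
  unfolding prefix_code_def inj_def by (metis append_Nil2)

lemma prefix_code_list:
  assumes "prefix_code e"
  shows "prefix_code (enc_list e)"
proof -
  have "enc_list e xs @ r = enc_list e ys @ s \<longrightarrow> xs = ys \<and> r = s" for xs ys r s
  proof (induction xs arbitrary: ys)
    case Nil
    then show ?case by (cases ys) (auto simp: enc_list_def)
  next
    case (Cons x xs)
    show ?case
    proof (cases ys)
      case Nil
      then show ?thesis by (auto simp: enc_list_def)
    next
      case ys: (Cons y ys')
      show ?thesis
      proof
        assume "enc_list e (x # xs) @ r = enc_list e ys @ s"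
        then have "e x @ (enc_list e xs @ r) = e y @ (enc_list e ys' @ s)"
          by (simp add: enc_list_def ys)
        from prefix_codeD [OF assms this] Cons.IH show "x # xs = ys \<and> r = s"
          by (simp add: ys)
      qed
    qed
  qed
  then show ?thesis unfolding prefix_code_def by blast
qed

lemma prefix_code_nat: "prefix_code enc_nat"
proof -
  have "prefix_code (enc_list (\<lambda>b :: bool. [b]))"
    by (rule prefix_code_list) (simp add: prefix_code_def)
  then show ?thesis
    unfolding prefix_code_def enc_nat_def using bits_inject by metis
qed

lemma prefix_code_gate: "prefix_code enc_gate"
proof -
  have "enc_gate g @ r = enc_gate h @ s \<longrightarrow> g = h \<and> r = s" for g h r s
    by (cases g; cases h) (auto dest!: prefix_codeD [OF prefix_code_nat])
  then show ?thesis unfolding prefix_code_def by blast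
qed

lemma inj_enc_circuit: "inj enc_circuit"
proof (rule injI)
  fix C D assume "enc_circuit C = enc_circuit D"
  then have *: "fst C = fst D \<and> enc_list enc_nat (snd C) = enc_list enc_nat (snd D)"
    unfolding enc_circuit_def by (rule prefix_codeD [OF prefix_code_list [OF prefix_code_gate]])
  then have "snd C = snd D"
    by (intro injD [OF prefix_code_inj [OF prefix_code_list [OF prefix_code_nat]]]) simp
  with * show "C = D" by (simp add: prod_eq_iff)
qed

lemma inj_enc_instance: "inj enc_instance"
proof (rule injI)
  have unary: "replicate m True @ False # r = replicate n True @ False # s \<longrightarrow> m = n \<and> r = s"
    for m n r s
  proof (induction m arbitrary: n)
    case 0
    then show ?case by (cases n) auto
  next
    case (Suc m)
    then show ?case by (cases n) auto
  qed
  fix x y assume eq: "enc_instance x = enc_instance y"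
  obtain n k C where x: "x = (n, k, C)" by (cases x)
  obtain n' k' C' where y: "y = (n', k', C')" by (cases y)
  from eq have "replicate n True @ False # (enc_nat k @ enc_circuit C) =
      replicate n' True @ False # (enc_nat k' @ enc_circuit C')"
    by (simp add: x y)
  with unary have *: "n = n'" "enc_nat k @ enc_circuit C = enc_nat k' @ enc_circuit C'"
    by blast+
  from prefix_codeD [OF prefix_code_nat *(2)] have "k = k'" "enc_circuit C = enc_circuit C'"
    by simp_all
  with *(1) injD [OF inj_enc_circuit, of C C'] show "x = y" by (simp add: x y)
qed

lemma inj_on_enc_sets: "inj_on enc_sets {(A, B). finite A \<and> finite B}"
proof (rule inj_onI)
  fix x y :: "nat set \<times> nat set"
  assume x: "x \<in> {(A, B). finite A \<and> finite B}" and y: "y \<in> {(A, B). finite A \<and> finite B}"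
    and eq: "enc_sets x = enc_sets y"
  obtain A B where AB: "x = (A, B)" by (cases x)
  obtain A' B' where AB': "y = (A', B')" by (cases y)
  from eq have *: "sorted_list_of_set A = sorted_list_of_set A' \<and> enc_set B = enc_set B'"
    unfolding AB AB' enc_sets.simps enc_set_def [of A] enc_set_def [of A']
    by (rule prefix_codeD [OF prefix_code_list [OF prefix_code_nat]])
  then have "sorted_list_of_set B = sorted_list_of_set B'"
    unfolding enc_set_def
    by (intro injD [OF prefix_code_inj [OF prefix_code_list [OF prefix_code_nat]]]) simp
  with * x y show "x = y"
    by (simp add: AB AB' sorted_list_of_set_inject)
qed

lemma enc_pair_inject: "enc_pair x y = enc_pair x' y' \<longleftrightarrow> x = x' \<and> y = y'"
proof (induction x arbitrary: x')
  case Nil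
  then show ?case by (cases x') (auto simp: enc_pair_def)
next
  case (Cons b x)
  then show ?case by (cases x') (auto simp: enc_pair_def)
qed

end

(*
  Doubling the elements embeds K(n div 2, k) into S(n, k). The number of colours of the Schrijver
  instance is exactly the one that Kneser allows for n div 2 and k. Precomposing the colouring with
  doubling replaces the input gate 2i by the input gate i and the odd input gates by constants;
  conversely, a monochromatic edge of K(n div 2, k) is simply doubled. Since the numbers are encoded
  in binary with the least significant bit first, both translations are computed by Mealy machines,
  which read their input once from left to right.
*)

theory Submission
  imports Defs "HOL-Combinatorics.Transposition"
begin

section \<open>Mealy machines\<close>

fun mealy :: "('s \<Rightarrow> bool \<Rightarrow> 's \<times> bool list) \<Rightarrow> 's \<Rightarrow> bool list \<Rightarrow> bool list" where
  "mealy \<delta> q [] = []"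
| "mealy \<delta> q (b # xs) = snd (\<delta> q b) @ mealy \<delta> (fst (\<delta> q b)) xs"

text \<open>The state \<open>q * (L + 1) + j\<close> means that the Mealy machine is in state q and that the first j
  letters of its answer to the scanned symbol have been written.\<close>

definition mealy_tm :: "nat \<Rightarrow> nat \<Rightarrow> (nat \<Rightarrow> bool \<Rightarrow> nat \<times> bool list) \<Rightarrow> tm" where
  "mealy_tm N L \<delta> =
     \<lparr> num_states = N * (L + 1), num_tapes = 2,
       trans = (\<lambda>s rs.
         case rs ! 0 of
           None \<Rightarrow> (N * (L + 1), [(None, Stay), (rs ! 1, Stay)])
         | Some b \<Rightarrow>
             let (q', w) = \<delta> (s div (L + 1)) b; j = s mod (L + 1)
             in if j < length w then (s + 1, [(Some b, Stay), (Some (w ! j), Right)])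
                else (q' * (L + 1), [(Some b, Right), (rs ! 1, Stay)])) \<rparr>"

lemma word_snoc: "(word xs)(length xs := Some b) = word (xs @ [b])"
  by (auto simp: word_def fun_eq_iff nth_append)

lemma funpow_step_halted: "fst c = num_states M \<Longrightarrow> (step M ^^ t) c = c"
  by (induction t) (auto simp: step_def)

lemma outputs_withinI:
  assumes "(step M ^^ t) (init_config M x) = c" "t \<le> T"
    and "fst c = num_states M" "fst (snd c ! 1) = word y"
  shows "outputs_within M x T y"
proof -
  have "(step M ^^ T) (init_config M x) = (step M ^^ (T - t)) ((step M ^^ t) (init_config M x))"
    using assms(2) by (metis comp_apply funpow_add le_add_diff_inverse2)
  then show ?thesis
    using assms by (simp add: outputs_within_def funpow_step_halted)
qed

section \<open>Correctness and running time of the Turing machine simulation\<close>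

context
  fixes N L :: nat and \<delta> :: "nat \<Rightarrow> bool \<Rightarrow> nat \<times> bool list"
  assumes next_less: "q < N \<Longrightarrow> fst (\<delta> q b) < N"
    and length_le: "q < N \<Longrightarrow> length (snd (\<delta> q b)) \<le> L"
begin

lemma wf_mealy_tm: "wf_tm (mealy_tm N L \<delta>)"
proof -
  have "fst (trans (mealy_tm N L \<delta>) s rs) \<le> N * (L + 1) \<and>
      length (snd (trans (mealy_tm N L \<delta>) s rs)) = 2"
    if s: "s < N * (L + 1)" for s rs
  proof -
    have "s div (L + 1) < N"
      using s by (simp add: less_mult_imp_div_less)
    then have "fst (\<delta> (s div (L + 1)) b) * (L + 1) \<le> N * (L + 1)" for b
      by (intro mult_le_mono1 less_imp_le next_less)
    then show ?thesis
      using s by (auto simp: mealy_tm_def Let_def split: option.split prod.split)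
        (metis fst_conv)
  qed
  then show ?thesis
    by (simp add: wf_tm_def) (simp add: mealy_tm_def)
qed

text \<open>One Mealy transition costs \<open>length w + 1\<close> machine steps: one per letter
  written, and one that advances the input head and enters the next state.\<close>

lemma mealy_tm_step:
  assumes "q < N" "i < length x"
  defines "w \<equiv> snd (\<delta> q (x ! i))"
  shows "(step (mealy_tm N L \<delta>) ^^ (length w + 1)) (q * (L + 1), [(word x, i), (word ys, length ys)]) =
    (fst (\<delta> q (x ! i)) * (L + 1), [(word x, i + 1), (word (ys @ w), length (ys @ w))])"
proof -
  let ?M = "mealy_tm N L \<delta>"
  have w: "length w \<le> L"
    using assms length_le by simp
  \<comment> \<open>The value \<open>j = L\<close> has to be covered: after an answer of full length
    one more state is needed for advancing the input head. Hence each Mealy state owns a block of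
    \<open>L + 1\<close> machine states.\<close>
  have state: "q * (L + 1) + j < N * (L + 1)" if "j \<le> L" for j
  proof -
    have "q * (L + 1) + j < (q + 1) * (L + 1)"
      using that by simp
    also have "\<dots> \<le> N * (L + 1)"
      using assms(1) by (intro mult_le_mono1) simp
    finally show ?thesis .
  qed
  have div_mod: "(q * (L + 1) + j) div (L + 1) = q" "(q * (L + 1) + j) mod (L + 1) = j"
    if "j \<le> L" for j
    using that by (simp_all only: div_mult_self3 mod_mult_self3) simp_all
  have input: "word x i = Some (x ! i)" "(word x)(i := Some (x ! i)) = word x"
    using assms(2) by (auto simp: word_def)
  have emit: "(step ?M ^^ j) (q * (L + 1), [(word x, i), (word ys, length ys)]) =
      (q * (L + 1) + j, [(word x, i), (word (ys @ take j w), length (ys @ take j w))])"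
    if "j \<le> length w" for j
    using that
  proof (induction j)
    case 0
    then show ?case by simp
  next
    case (Suc j)
    then have j: "j < length w" "j \<le> L"
      using w by auto
    have "\<delta> q (x ! i) = (fst (\<delta> q (x ! i)), w)"
      by (simp add: w_def)
    then have "step ?M (q * (L + 1) + j, [(word x, i), (word (ys @ take j w), length (ys @ take j w))]) =
        (q * (L + 1) + Suc j, [(word x, i), ((word (ys @ take j w))
          (length (ys @ take j w) := Some (w ! j)), length (ys @ take j w) + 1)])"
      using j state [OF j(2)] div_mod [OF j(2)]
      by (auto simp: step_def mealy_tm_def input act_def Let_def split: prod.split)
    also have "\<dots> = (q * (L + 1) + Suc j,
        [(word x, i), (word (ys @ take (Suc j) w), length (ys @ take (Suc j) w))])"
      using j by (simp only: word_snoc) (simp add: take_Suc_conv_app_nth)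
    finally show ?case
      using Suc by simp
  qed
  have "\<delta> q (x ! i) = (fst (\<delta> q (x ! i)), w)"
    by (simp add: w_def)
  then have "step ?M (q * (L + 1) + length w, [(word x, i), (word (ys @ w), length (ys @ w))]) =
      (fst (\<delta> q (x ! i)) * (L + 1), [(word x, i + 1), (word (ys @ w), length (ys @ w))])"
    using state [OF w] div_mod [OF w]
    by (auto simp: step_def mealy_tm_def input act_def Let_def split: prod.split)
  then show ?thesis
    using emit [of "length w"] by simp
qed

text \<open>Induction from the right end of the input, with the output written so far kept general.
  Each letter left costs at most \<open>L + 1\<close> steps, and the last step halts on the blank
  behind the input.\<close>

lemma mealy_tm_run:
  assumes "q < N" "i \<le> length x"
  shows "\<exists>t \<le> (L + 1) * (length x - i) + 1.
    (step (mealy_tm N L \<delta>) ^^ t) (q * (L + 1), [(word x, i), (word ys, length ys)]) =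
    (N * (L + 1), [(word x, length x),
      (word (ys @ mealy \<delta> q (drop i x)), length (ys @ mealy \<delta> q (drop i x)))])"
  using assms(2,1)
proof (induction i arbitrary: q ys rule: inc_induct)
  case base
  then have "q * (L + 1) < N * (L + 1)"
    by (intro mult_less_mono1) simp_all
  moreover have "word x (length x) = None"
    by (simp add: word_def)
  ultimately show ?case
    by (intro exI [of _ 1]) (auto simp: step_def mealy_tm_def act_def Let_def)
next
  case (step i)
  define w where "w = snd (\<delta> q (x ! i))"
  define q' where "q' = fst (\<delta> q (x ! i))"
  have "q' < N"
    using step.prems next_less by (simp add: q'_def)
  from step.IH [OF this, of "ys @ w"] obtain t where
    t: "t \<le> (L + 1) * (length x - Suc i) + 1" and
    run: "(Defs.step (mealy_tm N L \<delta>) ^^ t)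
        (q' * (L + 1), [(word x, Suc i), (word (ys @ w), length (ys @ w))]) =
      (N * (L + 1), [(word x, length x),
        (word ((ys @ w) @ mealy \<delta> q' (drop (Suc i) x)),
         length ((ys @ w) @ mealy \<delta> q' (drop (Suc i) x)))])"
    by blast
  have drop: "mealy \<delta> q (drop i x) = w @ mealy \<delta> q' (drop (Suc i) x)"
    using step.hyps by (simp flip: Cons_nth_drop_Suc add: w_def q'_def)
  have "(Defs.step (mealy_tm N L \<delta>) ^^ (t + (length w + 1)))
      (q * (L + 1), [(word x, i), (word ys, length ys)]) =
    (N * (L + 1), [(word x, length x),
      (word (ys @ mealy \<delta> q (drop i x)), length (ys @ mealy \<delta> q (drop i x)))])"
    unfolding funpow_add [of t] comp_apply drop
    using run mealy_tm_step [OF step.prems step.hyps(2), of ys, folded w_def q'_def]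
    by (simp only: Suc_eq_plus1 append_assoc)
  moreover have "t + (length w + 1) \<le> (L + 1) * (length x - i) + 1"
  proof -
    have "length x - i = Suc (length x - Suc i)"
      using step.hyps by simp
    then show ?thesis
      using t length_le [OF step.prems, of "x ! i"] by (simp add: w_def)
  qed
  ultimately show ?case by blast
qed

lemma mealy_tm_outputs:
  assumes "0 < N"
  shows "outputs_within (mealy_tm N L \<delta>) x ((L + 1) * length x + 1) (mealy \<delta> 0 x)"
proof -
  have "init_config (mealy_tm N L \<delta>) x = (0 * (L + 1), [(word x, 0), (word [], length [])])"
    by (simp add: init_config_def mealy_tm_def)
  moreover obtain t where "t \<le> (L + 1) * length x + 1"
    "(step (mealy_tm N L \<delta>) ^^ t) (0 * (L + 1), [(word x, 0), (word [], length [])]) =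
      (N * (L + 1), [(word x, length x), (word (mealy \<delta> 0 x), length (mealy \<delta> 0 x))])"
    using mealy_tm_run [OF assms, of 0 x "[]"] by auto
  ultimately show ?thesis
    by (intro outputs_withinI [where t = t and c = "(N * (L + 1),
        [(word x, length x), (word (mealy \<delta> 0 x), length (mealy \<delta> 0 x))])"])
      (simp_all only:, simp_all add: mealy_tm_def)
qed

end

text \<open>An injective renaming \<open>h\<close> of the states, with left inverse
  \<open>r\<close>, leaves the answers alone; this lets numbers replace the states of an arbitrary
  finite type.\<close>

lemma mealy_rename:
  assumes "\<And>q. r (h q) = q"
  shows "mealy (\<lambda>n b. map_prod h id (\<delta> (r n) b)) (h q) xs = mealy \<delta> q xs"
  using assms by (induction xs arbitrary: q) simp_all

text \<open>Finitely many states and letters give finitely many answers, hence a bound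
  \<open>L\<close> on their lengths; the simulation then runs in linear time.\<close>

lemma poly_time_computable_mealy:
  fixes \<delta> :: "'s::finite \<Rightarrow> bool \<Rightarrow> 's \<times> bool list"
  assumes "\<And>x. x \<in> D \<Longrightarrow> eb (f x) = mealy \<delta> q0 (ea x)"
  shows "poly_time_computable D ea eb f"
proof -
  define N where "N = card (UNIV :: 's set)"
  obtain h0 :: "'s \<Rightarrow> nat" where h0: "bij_betw h0 UNIV {0..<N}"
    unfolding N_def using ex_bij_betw_finite_nat [of "UNIV :: 's set"] by auto
  \<comment> \<open>Swapping two numbers gives \<open>q0\<close> the number 0, because a Turing
    machine starts in state 0.\<close>
  define h where "h = transpose (h0 q0) 0 \<circ> h0"
  have N: "0 < N"
    unfolding N_def by (simp add: card_gt_0_iff)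
  have "h0 q < N" for q
    using bij_betw_apply [OF h0, of q] by simp
  then have h_less: "h q < N" for q
    using N by (auto simp: h_def transpose_def)
  have h_q0: "h q0 = 0"
    by (simp add: h_def)
  have "inj h"
    unfolding h_def using h0 by (intro inj_compose) (auto simp: bij_betw_def)
  then have inv_h: "inv h (h q) = q" for q
    by simp
  define L where "L = Max (range (\<lambda>(q, b). length (snd (\<delta> q b))))"
  have L: "length (snd (\<delta> q b)) \<le> L" for q b
    unfolding L_def by (rule Max_ge) (auto intro: range_eqI [of _ _ "(q, b)"])
  \<comment> \<open>Outside the range of \<open>h\<close> the value of \<open>inv h\<close> is an
    arbitrary state. This is harmless: the bounds below hold for every \<open>n\<close>, and a run
    from \<open>h q0\<close> stays in the range.\<close>
  define \<delta>' where "\<delta>' = (\<lambda>n b. map_prod h id (\<delta> (inv h n) b))"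
  have *: "fst (\<delta>' n b) < N" "length (snd (\<delta>' n b)) \<le> L" for n b
    by (simp_all add: \<delta>'_def h_less L)
  have "mealy \<delta>' 0 xs = mealy \<delta> q0 xs" for xs
    using mealy_rename [of "inv h" h \<delta> q0 xs, OF inv_h] by (simp add: \<delta>'_def h_q0)
  then have "outputs_within (mealy_tm N L \<delta>') (ea x)
      (poly [:1, L + 1:] (length (ea x))) (eb (f x))" if "x \<in> D" for x
    using mealy_tm_outputs [of N \<delta>' L "ea x", OF * N] assms [OF that]
    by (simp add: algebra_simps)
  then show ?thesis
    unfolding poly_time_computable_def using wf_mealy_tm [of N \<delta>' L, OF *] by blast
qed


section \<open>Halving the inputs of a circuit\<close>

text \<open>All elements of \<open>double A\<close> are even, so odd inputs are constantly false.
  One gate replaces one gate, which keeps the numbering and thus all references intact.\<close>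

fun halve_gate :: "gate \<Rightarrow> gate" where
  "halve_gate (Input i) = (if even i then Input (i div 2) else Const False)"
| "halve_gate g = g"

definition halve_circuit :: "circuit \<Rightarrow> circuit" where
  "halve_circuit C = (map halve_gate (fst C), snd C)"

definition double :: "nat set \<Rightarrow> nat set" where
  "double A = (\<lambda>a. 2 * a) ` A"

lemma mem_double: "i \<in> double A \<longleftrightarrow> even i \<and> i div 2 \<in> A"
  by (auto simp: double_def)

lemma eval_halve_gate:
  "eval_gate (\<lambda>i. i \<in> A) vs (halve_gate g) = eval_gate (\<lambda>i. i \<in> double A) vs g"
  by (cases g) (auto simp: mem_double)

lemma circuit_colour_halve: "circuit_colour (halve_circuit C) A = circuit_colour C (double A)"
  by (simp add: circuit_colour_def eval_circuit_def halve_circuit_def foldl_map eval_halve_gate)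

lemma wf_halve_gate: "wf_gate n j g \<Longrightarrow> wf_gate (n div 2) j (halve_gate g)"
  by (cases g) (auto simp: div_le_mono elim!: evenE)

lemma wf_halve_circuit: "wf_circuit n C \<Longrightarrow> wf_circuit (n div 2) (halve_circuit C)"
  by (auto simp: wf_circuit_def halve_circuit_def wf_halve_gate)

text \<open>Even numbers are never consecutive, and 1 is odd, so the pair of 1 and \<open>n\<close>
  is excluded as well.\<close>

lemma double_stable:
  assumes "A \<in> k_subsets (n div 2) k"
  shows "double A \<in> stable_k_subsets n k"
proof -
  have "double A \<subseteq> {1..n}"
    using assms by (fastforce simp: double_def k_subsets_def)
  moreover have "card (double A) = k"
    using assms by (auto simp: double_def k_subsets_def card_image inj_on_def)
  ultimately show ?thesis
    by (auto simp: stable_k_subsets_def k_subsets_def stable_def mem_double)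
qed

lemma double_disjoint: "A \<inter> B = {} \<Longrightarrow> double A \<inter> double B = {}"
  by (auto simp: double_def)

text \<open>Supplies a vertex whose colour witnesses that the number of colours is positive. The
  double of \<open>{1..k}\<close> is such a vertex.\<close>

lemma stable_k_subsets_nonempty: "2 * k \<le> n \<Longrightarrow> stable_k_subsets n k \<noteq> {}"
proof -
  assume "2 * k \<le> n"
  then have "{1..k} \<in> k_subsets (n div 2) k"
    by (auto simp: k_subsets_def)
  from double_stable [OF this] show ?thesis by blast
qed


section \<open>Translating the encodings\<close>

lemma enc_list_Nil: "enc_list e [] = [False]"
  by (simp add: enc_list_def)

lemma enc_list_Cons: "enc_list e (x # xs) = True # e x @ enc_list e xs"
  by (simp add: enc_list_def)

text \<open>The lowest bit comes first, so halving removes the leading mark and digit, and doubling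
  puts a mark and the digit \<open>False\<close> in front.\<close>

lemma enc_nat_pos: "0 < i \<Longrightarrow> enc_nat i = True # odd i # enc_nat (i div 2)"
  by (simp add: enc_nat_def bits.simps [of i] enc_list_Cons)

text \<open>In an encoded number marks and digits alternate, so two states suffice for copying; the
  closing mark \<open>False\<close> leads on to \<open>q\<close>.\<close>

lemma mealy_copy_nat:
  assumes "\<delta> mark True = (digit, [True])" "\<delta> mark False = (q, [False])"
    and "\<And>b. \<delta> digit b = (mark, [b])"
  shows "mealy \<delta> mark (enc_nat i @ r) = enc_nat i @ mealy \<delta> q r"
proof -
  have "mealy \<delta> mark (enc_list (\<lambda>b. [b]) bs @ r) = enc_list (\<lambda>b. [b]) bs @ mealy \<delta> q r" for bs
    using assms by (induction bs) (simp_all add: enc_list_Nil enc_list_Cons)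
  then show ?thesis
    by (simp add: enc_nat_def)
qed

section \<open>The Mealy machine for instances\<close>

datatype instance_state =
  Unary_Even | Unary_Odd | Gates | Op | Op_False | Op_True | Const_Value | Op_False_True |
  Input_Mark | Input_Bit | Skip_Mark | Skip_Bit |
  First_Mark | First_Bit | Last_Mark | Last_Bit | Copy

instance instance_state :: finite
proof
  have "(UNIV :: instance_state set) \<subseteq>
      {Unary_Even, Unary_Odd, Gates, Op, Op_False, Op_True, Const_Value, Op_False_True,
       Input_Mark, Input_Bit, Skip_Mark, Skip_Bit,
       First_Mark, First_Bit, Last_Mark, Last_Bit, Copy}"
    by (auto intro: instance_state.exhaust)
  then show "finite (UNIV :: instance_state set)"
    by (rule finite_subset) simp
qed

text \<open>The tag of an input gate is held back until the lowest bit of its number, which decides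
  between an input and a constant, has been read.\<close>

fun translate_instance :: "instance_state \<Rightarrow> bool \<Rightarrow> instance_state \<times> bool list" where
  "translate_instance Unary_Even b = (if b then (Unary_Odd, []) else (Last_Mark, [False]))"
| "translate_instance Unary_Odd b = (if b then (Unary_Even, [True]) else (Last_Mark, [False]))"
| "translate_instance Gates b = (if b then (Op, [True]) else (Copy, [False]))"
| "translate_instance Op b = (if b then Op_True else Op_False, [b])"
| "translate_instance Op_True b = (First_Mark, [b])"
| "translate_instance Op_False b = (if b then (Op_False_True, []) else (Const_Value, [False]))"
| "translate_instance Const_Value b = (Gates, [b])"
| "translate_instance Op_False_True b = (if b then (Last_Mark, [True, True]) else (Input_Mark, []))"
| "translate_instance Input_Mark b = (Input_Bit, [])"
| "translate_instance Input_Bit b =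
     (if b then (Skip_Mark, [False, False]) else (Last_Mark, [True, False]))"
| "translate_instance Skip_Mark b = (if b then Skip_Bit else Gates, [])"
| "translate_instance Skip_Bit b = (Skip_Mark, [])"
| "translate_instance First_Mark b = (if b then First_Bit else Last_Mark, [b])"
| "translate_instance First_Bit b = (First_Mark, [b])"
| "translate_instance Last_Mark b = (if b then Last_Bit else Gates, [b])"
| "translate_instance Last_Bit b = (Last_Mark, [b])"
| "translate_instance Copy b = (Copy, [b])"

text \<open>Treats the first operand of a binary gate, which a second number follows.\<close>

lemma translate_first: "mealy translate_instance First_Mark (enc_nat i @ r) =
    enc_nat i @ mealy translate_instance Last_Mark r"
  by (rule mealy_copy_nat [where digit = First_Bit]) simp_all

text \<open>Treats the last number of a gate, and also \<open>k\<close>, which the list of gates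
  follows too.\<close>

lemma translate_last: "mealy translate_instance Last_Mark (enc_nat i @ r) =
    enc_nat i @ mealy translate_instance Gates r"
  by (rule mealy_copy_nat [where digit = Last_Bit]) simp_all

lemma translate_skip: "mealy translate_instance Skip_Mark (enc_nat i @ r) =
    mealy translate_instance Gates r"
proof -
  have "mealy translate_instance Skip_Mark (enc_list (\<lambda>b. [b]) bs @ r) =
      mealy translate_instance Gates r" for bs
    by (induction bs) (simp_all add: enc_list_Nil enc_list_Cons)
  then show ?thesis
    by (simp add: enc_nat_def)
qed

text \<open>Behind the gates only the numbers of the output gates remain, and these do not
  change.\<close>

lemma translate_copy: "mealy translate_instance Copy xs = xs"
  by (induction xs) simp_all

text \<open>Well-formedness makes input numbers positive, so a lowest bit exists. If it is 0, the
  delayed tag is completed and the other digits, which encode the half, are copied; if it is 1,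
  \<open>Const False\<close> is completed and they are skipped.\<close>

lemma translate_gate:
  assumes "wf_gate n j g"
  shows "mealy translate_instance Op (enc_gate g @ r) =
    enc_gate (halve_gate g) @ mealy translate_instance Gates r"
  using assms
  by (cases g) (simp_all add: translate_first translate_last translate_skip enc_nat_pos)

lemma translate_gates:
  assumes "\<And>g. g \<in> set gs \<Longrightarrow> \<exists>n j. wf_gate n j g"
  shows "mealy translate_instance Gates (enc_list enc_gate gs @ r) =
    enc_list enc_gate (map halve_gate gs) @ r"
  using assms
proof (induction gs)
  case Nil
  then show ?case by (simp add: enc_list_Nil translate_copy)
next
  case (Cons g gs)
  from Cons.prems obtain n j where "wf_gate n j g" by (meson list.set_intros(1))
  with Cons show ?case by (simp add: enc_list_Cons translate_gate)
qed

text \<open>Every second \<open>True\<close> is passed on, which rounds an odd \<open>n\<close>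
  down; hence the induction in steps of two.\<close>

lemma translate_unary: "mealy translate_instance Unary_Even (replicate n True @ False # r) =
    replicate (n div 2) True @ False # mealy translate_instance Last_Mark r"
  by (induction n rule: induct_nat_012) simp_all

lemma translate_instance:
  assumes "wf_circuit n C"
  shows "mealy translate_instance Unary_Even (enc_instance (n, k, C)) =
    enc_instance (n div 2, k, halve_circuit C)"
proof -
  have "\<exists>n j. wf_gate n j g" if "g \<in> set (fst C)" for g
    using assms that by (auto simp: wf_circuit_def in_set_conv_nth)
  then show ?thesis
    by (simp add: translate_unary translate_last enc_circuit_def translate_gates halve_circuit_def)
qed

section \<open>The Mealy machine for solutions\<close>

datatype solution_state = Pair_First | Pair_Second bool | Items | Item_Mark | Item_Bit

instance solution_state :: finite
proof
  have "(UNIV :: solution_state set) \<subseteq>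
      {Pair_First, Pair_Second True, Pair_Second False, Items, Item_Mark, Item_Bit}"
    by (auto intro: solution_state.exhaust)
  then show "finite (UNIV :: solution_state set)"
    by (rule finite_subset) simp
qed

text \<open>The instance is skipped as a sequence of equal pairs of bits, up to the separator 01,
  the first unequal pair. In \<open>[True, True, False]\<close> the first letter announces an
  element, and the other two are a mark and the new lowest digit 0.\<close>

fun translate_solution :: "solution_state \<Rightarrow> bool \<Rightarrow> solution_state \<times> bool list" where
  "translate_solution Pair_First b = (Pair_Second b, [])"
| "translate_solution (Pair_Second a) b = (if a = b then Pair_First else Items, [])"
| "translate_solution Items b = (if b then (Item_Mark, [True, True, False]) else (Items, [False]))"
| "translate_solution Item_Mark b = (if b then Item_Bit else Items, [b])"
| "translate_solution Item_Bit b = (Item_Mark, [b])"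

lemma translate_pair: "mealy translate_solution Pair_First (enc_pair xs ys) =
    mealy translate_solution Items ys"
  unfolding enc_pair_def by (induction xs) simp_all

lemma translate_item: "mealy translate_solution Item_Mark (enc_nat i @ r) =
    enc_nat i @ mealy translate_solution Items r"
  by (rule mealy_copy_nat [where digit = Item_Bit]) simp_all

text \<open>A new lowest digit 0 doubles a positive number; for 0 it would be a leading zero, which
  \<open>bits\<close> excludes.\<close>

lemma translate_items:
  assumes "\<forall>i \<in> set is. 0 < i"
  shows "mealy translate_solution Items (enc_list enc_nat is @ r) =
    enc_list enc_nat (map (\<lambda>i. 2 * i) is) @ mealy translate_solution Items r"
  using assms
  by (induction "is") (simp_all add: enc_list_Nil enc_list_Cons translate_item enc_nat_pos)

text \<open>Doubling is strictly increasing, so a set can be doubled element by element in the order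
  of its encoding.\<close>

lemma sorted_list_of_set_double:
  assumes "finite A"
  shows "sorted_list_of_set (double A) = map (\<lambda>i. 2 * i) (sorted_list_of_set A)"
proof (rule sorted_distinct_set_unique)
  show "sorted (map (\<lambda>i. 2 * i) (sorted_list_of_set A))"
    by (simp add: sorted_map sorted_wrt_mono_rel [OF _ sorted_list_of_set(2)])
qed (use assms in \<open>auto simp: double_def distinct_map inj_on_def\<close>)

lemma translate_set:
  assumes "A \<in> k_subsets n k"
  shows "mealy translate_solution Items (enc_set A @ r) =
    enc_set (double A) @ mealy translate_solution Items r"
proof -
  have A: "A \<subseteq> {1..n}"
    using assms by (simp add: k_subsets_def)
  then have "finite A"
    by (rule finite_subset) simp
  then show ?thesis
    using A by (auto simp: enc_set_def sorted_list_of_set_double intro!: translate_items)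
qed

lemma translate_solution:
  assumes "A \<in> k_subsets n k" "B \<in> k_subsets n k"
  shows "mealy translate_solution Pair_First (enc_pair xs (enc_sets (A, B))) =
    enc_sets (double A, double B)"
  using translate_set [OF assms(1), of "enc_set B"] translate_set [OF assms(2), of "[]"]
  by (simp add: translate_pair)

section \<open>The reduction\<close>

theorem theorem1p2:
  shows "poly_time_reducible (Schrijver (\<lambda>n k. \<lfloor>real n / 2\<rfloor> - 2 * int k + 1)) Kneser"
proof -
  let ?P = "Schrijver (\<lambda>n k. \<lfloor>real n / 2\<rfloor> - 2 * int k + 1)"
  define f :: "nat \<times> nat \<times> circuit \<Rightarrow> nat \<times> nat \<times> circuit" where
    "f = (\<lambda>(n, k, C). (n div 2, k, halve_circuit C))"
  define g :: "(nat \<times> nat \<times> circuit) \<times> nat set \<times> nat set \<Rightarrow> nat set \<times> nat set" where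
    "g = (\<lambda>(x, A, B). (double A, double B))"
  have floor: "\<lfloor>real n / 2\<rfloor> = int (n div 2)" for n
    by linarith
  have "f x \<in> instances Kneser \<and> (\<forall>y \<in> solutions Kneser (f x). g (x, y) \<in> solutions ?P x)"
    if x: "x \<in> instances ?P" for x
  proof -
    obtain n k C where [simp]: "x = (n, k, C)" by (cases x)
    from x have *: "0 < k" "2 * k \<le> n" "wf_circuit n C"
      and colour: "A \<in> stable_k_subsets n k \<Longrightarrow>
        circuit_colour C A \<in> {1..int (n div 2) - 2 * int k + 1}" for A
      by (auto simp: Schrijver_def monochromatic_edge_problem_def floor)
    \<comment> \<open>Some stable set has a colour, so the interval of colours is nonempty, that is,
      \<open>1 \<le> int (n div 2) - 2 * int k + 1\<close>.\<close>
    have "2 * k \<le> n div 2"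
      using stable_k_subsets_nonempty [OF *(2)] colour by fastforce
    then show ?thesis
      using * colour [OF double_stable]
      by (auto simp: Schrijver_def Kneser_def monochromatic_edge_problem_def f_def g_def
        wf_halve_circuit circuit_colour_halve double_stable double_disjoint)
  qed
  moreover have "poly_time_computable (instances ?P) (enc_inst ?P) (enc_inst Kneser) f"
    by (rule poly_time_computable_mealy [where \<delta> = translate_instance and ?q0.0 = Unary_Even])
      (auto simp: Schrijver_def Kneser_def monochromatic_edge_problem_def f_def
        translate_instance simp del: enc_instance.simps)
  moreover have "poly_time_computable {(x, y). x \<in> instances ?P \<and> y \<in> solutions Kneser (f x)}
      (\<lambda>(x, y). enc_pair (enc_inst ?P x) (enc_sol Kneser y)) (enc_sol ?P) g"
    by (rule poly_time_computable_mealy [where \<delta> = translate_solution and ?q0.0 = Pair_First])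
      (auto simp: Schrijver_def Kneser_def monochromatic_edge_problem_def f_def g_def
        translate_solution simp del: enc_sets.simps)
  ultimately show ?thesis
    unfolding poly_time_reducible_def by blast
qed

end
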